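(* Let $f_b$ denote the Kauffman bracket polynomial of the billiard table diagram $T(3,b)$ with arbitrary (indeterminate) crossing signs, in tuple notation, and let $C=[A^\pm,A^\pm]+[f_2^\mp,A^\mp]$. Substituting $C$ starting from the left as often as possible, the polynomials $f_b$ obey the following recursion rules, which produce the expression for $f_b$ from that for $f_{b-1}$ (for $b\ge5$, starting from the expression for $f_4$ below). If a summand in $f_{b-1}$ ends in: (A) $(\ldots,A^\pm)$, then it appears as a summand in $f_b$ with a $C$ replacing the $A^\pm$; (f) $(\ldots,[f_2^\mp,A^\mp])$, then it appears as a summand in $f_b$ with an additional final entry $A^\pm$, i.e. $(\ldots,[f_2^\mp,A^\mp],A^\pm)$; (C) $(\ldots,C)$, then it appears as two summands in $f_b$, with $[C,A^\pm]+[A^\pm,f_2^\mp,A^\mp]$ replacing the $C$. In particular, writing $H=[f_2^\mp,A^\mp]$ and $V=A^\pm$ (and $f_2^\pm$ for the first entry): $$f_3=(f_2^\pm,A^\pm)+(f_2^\mp,A^\mp),\qquad f_4=(f_3,V)+(f_2^\pm,H),\qquad f_5=(f_3,C)+(f_2^\pm,H,V),$$ $$f_6=(f_3,[C,V]+[V,H])+(f_2^\pm,H,C),$$ $$f_7=(f_3,C,C)+(f_3,V,H,V)+(f_2^\pm,H,[C,V]+[V,H]),$$ $$f_8=(f_3,C,[C,V]+[V,H])+(f_3,V,H,C)+(f_2^\pm,H,C,C)+(f_2^\pm,H,V,H,V),$$ $$f_9=(f_3,C,C,C)+(f_3,C,V,H,V)+(f_3,V,H,[C,V]+[V,H])+(f_2^\pm,H,C,[C,V]+[V,H])+(f_2^\pm,H,V,H,C),$$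 $$f_{10}=(f_3,C,C,[C,V]+[V,H])+(f_3,C,V,H,C)+(f_3,V,H,C,C)+(f_3,V,H,V,H,V)$$ $$\quad+(f_2^\pm,H,C,C,C)+(f_2^\pm,H,C,V,H,V)+(f_2^\pm,H,V,H,[C,V]+[V,H]).$$
   Context: **Diagrams.** The billiard table diagram $T(3,b)$ is the intersection of the table $[0,b]\times[0,3]$ with all lines $x+y\in2\mathbb Z$ and $x-y\in2\mathbb Z$ (unions of billiard trajectories reflecting off the walls; closed trajectories are included). Its crossings are the interior lattice points with $x+y$ even: one in each column $x=1,\dots,b-1$, numbered $1,\dots,b-1$ from left to right. There is exactly one long arc, starting at $(0,0)$ and ending at another corner; its ends are joined outside the table without additional crossings. Each crossing independently has a sign: it is positive if the strand of slope $+1$ is the overstrand, negative otherwise. Equivalently, the "vertical" smoothing $)($ (joining SW to NW and SE to NE) has weight $A$ at a positive crossing and $A^{-1}$ at a negative one, the other smoothing having the inverse weight. (This class includes all 2-bridge knots.) **Kauffman bracket.** $\langle L\rangle=A\langle L_0\rangle+A^{-1}\langle L_\infty\rangle$ for the $A$- and $B$-smoothings of a crossing, $\langle U\sqcup L\rangle=\delta\langle L\rangle$, $\langle U\rangle=1$, with $U$ the unknot and $\delta=-A^2-A^{-2}$. One has $f_1=1$ and $f_2^\pm=-A^{\mp3}$. **Tuple notation.** A tuple denotes the product of its entries; the entry in position $k$ is evaluated by the sign $\varepsilon_k=\pm1$ of the $k$-th crossing: $A^\pm\mapsto A^{\varepsilon_k}$, $A^\mp\mapsto A^{-\varepsilon_k}$,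 $f_2^\pm\mapsto -A^{-3\varepsilon_k}$, $f_2^\mp\mapsto-A^{3\varepsilon_k}$. Square brackets denote sub-blocks occupying consecutive positions and concatenated into the surrounding tuple; sums of blocks are distributed multilinearly. The symbols $f_3$ and $C$ each occupy two positions; $f_3$ as first entry is evaluated on the first two crossing signs. A summand is a formal tuple whose entries are an initial symbol $f_3$ or $f_2^\pm$ followed by symbols $A^\pm$, $[f_2^\mp,A^\mp]$, $C$; the rules act on these formal summands, with sums such as $[C,A^\pm]+[A^\pm,f_2^\mp,A^\mp]$ split into separate summands, and the resulting formal sum evaluates to the Kauffman bracket of $T(3,b)$ for every choice of signs. *)

theory Defs
  imports Main "HOL-Library.Multiset" "HOL-Library.FuncSet" "HOL-Library.Poly_Mapping"
begin

section \<open>Laurent polynomials in the indeterminate A\<close>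

text \<open>The convolution product on \<open>int \<Rightarrow>\<^sub>0 int\<close> makes this type the group ring of the integers,
  i.e. the ring of integral Laurent polynomials.\<close>

type_synonym laurent = "int \<Rightarrow>\<^sub>0 int"

definition A_pow :: "int \<Rightarrow> laurent" where
  "A_pow k = Poly_Mapping.single k 1"

definition loop_value :: laurent where
  "loop_value = - A_pow 2 - A_pow (- 2)"


section \<open>The Kauffman bracket\<close>

text \<open>A link diagram is given by a set \<open>S\<close> of arcs, a relation \<open>J\<close> recording which arcs are glued
  end to end, and a list of crossings. A crossing \<open>(a, b, c, d)\<close> lists the four incident arcs in
  counterclockwise order, starting with an end of the understrand; so \<open>a\<close>, \<open>c\<close> belong to the
  understrand and \<open>b\<close>, \<open>d\<close> to the overstrand. The regions swept by the overstrand when it is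
  turned counterclockwise are the ones between \<open>b\<close>, \<open>c\<close> and between \<open>d\<close>, \<open>a\<close>. The A-smoothing
  merges these two regions, that is, it glues \<open>a\<close> to \<open>b\<close> and \<open>c\<close> to \<open>d\<close>; the B-smoothing glues
  \<open>b\<close> to \<open>c\<close> and \<open>d\<close> to \<open>a\<close>.\<close>

type_synonym 'e crossing = "'e \<times> 'e \<times> 'e \<times> 'e"

definition num_components :: "'e set \<Rightarrow> ('e \<times> 'e) set \<Rightarrow> nat" where
  "num_components S J = card (S // (J \<union> J\<inverse>)\<^sup>*)"

text \<open>A diagram without crossings is a disjoint union of \<open>n \<ge> 1\<close> circles, whose bracket is the
  \<open>n - 1\<close>-st power of the loop value.\<close>

fun kauffman_bracket :: "'e set \<Rightarrow> ('e \<times> 'e) set \<Rightarrow> 'e crossing list \<Rightarrow> laurent" where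
  "kauffman_bracket S J [] = loop_value ^ (num_components S J - 1)"
| "kauffman_bracket S J ((a, b, c, d) # X) =
     A_pow 1 * kauffman_bracket S (J \<union> {(a, b), (c, d)}) X
   + A_pow (- 1) * kauffman_bracket S (J \<union> {(b, c), (d, a)}) X"


section \<open>The billiard table diagram T(3,b)\<close>

text \<open>The lines with \<open>x + y\<close> or \<open>x - y\<close> an even integer meet each unit square
  \<open>[i, i+1] \<times> [j, j+1]\<close> in exactly one of its diagonals, the one joining the two vertices with
  even coordinate sum. We use \<open>(i, j)\<close> as the name of this piece of trajectory.\<close>

definition segments :: "nat \<Rightarrow> (nat \<times> nat) set" where
  "segments b = {0..<b} \<times> {0..<3}"

definition seg_ends :: "nat \<times> nat \<Rightarrow> (nat \<times> nat) set" where
  "seg_ends s = {(x, y). x \<in> {fst s, fst s + 1} \<and> y \<in> {snd s, snd s + 1} \<and> even (x + y)}"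

definition on_wall :: "nat \<Rightarrow> nat \<times> nat \<Rightarrow> bool" where
  "on_wall b p \<longleftrightarrow> fst p \<in> {0, b} \<or> snd p \<in> {0, 3}"

definition is_corner :: "nat \<Rightarrow> nat \<times> nat \<Rightarrow> bool" where
  "is_corner b p \<longleftrightarrow> fst p \<in> {0, b} \<and> snd p \<in> {0, 3}"

text \<open>Segments are glued where the trajectory reflects off a wall. Exactly two corners have even
  coordinate sum; they are the ends of the long arc, and are joined outside the table.\<close>

definition joints :: "nat \<Rightarrow> ((nat \<times> nat) \<times> (nat \<times> nat)) set" where
  "joints b =
     {(s, t). s \<in> segments b \<and> t \<in> segments b \<and> (\<exists>p \<in> seg_ends s \<inter> seg_ends t. on_wall b p)}
   \<union> {(s, t). s \<in> segments b \<and> t \<in> segments b \<and>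
        (\<exists>p \<in> seg_ends s. is_corner b p) \<and> (\<exists>q \<in> seg_ends t. is_corner b q)}"

text \<open>The crossing in column \<open>x\<close> is the point \<open>(x, y)\<close> with \<open>y \<in> {1, 2}\<close> and \<open>x + y\<close> even. It is
  positive if the strand of slope 1, from SW to NE, is the overstrand.\<close>

definition column_crossing :: "(nat \<Rightarrow> int) \<Rightarrow> nat \<Rightarrow> (nat \<times> nat) crossing" where
  "column_crossing \<epsilon> x =
     (let y = (if odd x then 1 else 2);
          SW = (x - 1, y - 1); SE = (x, y - 1); NE = (x, y); NW = (x - 1, y)
      in if \<epsilon> x = 1 then (SE, NE, NW, SW) else (SW, SE, NE, NW))"

definition T3_bracket :: "nat \<Rightarrow> (nat \<Rightarrow> int) \<Rightarrow> laurent" where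
  "T3_bracket b \<epsilon> =
     kauffman_bracket (segments b) (joints b) (map (column_crossing \<epsilon>) [1..<b])"

definition crossing_signs :: "nat \<Rightarrow> (nat \<Rightarrow> int) set" where
  "crossing_signs b = {1..<b} \<rightarrow> {1, - 1}"


section \<open>Tuple notation\<close>

text \<open>\<open>Apm\<close>, \<open>Amp\<close>, \<open>f2pm\<close>, \<open>f2mp\<close> stand for the entries with superscript plus-minus or
  minus-plus.\<close>

datatype entry = Apm | Amp | f2pm | f2mp

fun entry_value :: "entry \<Rightarrow> int \<Rightarrow> laurent" where
  "entry_value Apm e = A_pow e"
| "entry_value Amp e = A_pow (- e)"
| "entry_value f2pm e = - A_pow (- 3 * e)"
| "entry_value f2mp e = - A_pow (3 * e)"

text \<open>The value of a tuple whose first entry sits in position \<open>k\<close>.\<close>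

fun tuple_value :: "(nat \<Rightarrow> int) \<Rightarrow> nat \<Rightarrow> entry list \<Rightarrow> laurent" where
  "tuple_value \<epsilon> k [] = 1"
| "tuple_value \<epsilon> k (e # es) = entry_value e (\<epsilon> k) * tuple_value \<epsilon> (Suc k) es"

datatype symbol = V | H | C

fun blocks :: "symbol \<Rightarrow> entry list list" where
  "blocks V = [[Apm]]"
| "blocks H = [[f2mp, Amp]]"
| "blocks C = [[Apm, Apm], [f2mp, Amp]]"

fun width :: "symbol \<Rightarrow> nat" where
  "width V = 1"
| "width H = 2"
| "width C = 2"

fun word_value :: "(nat \<Rightarrow> int) \<Rightarrow> nat \<Rightarrow> symbol list \<Rightarrow> laurent" where
  "word_value \<epsilon> k [] = 1"
| "word_value \<epsilon> k (s # w) =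
     sum_list (map (tuple_value \<epsilon> k) (blocks s)) * word_value \<epsilon> (k + width s) w"

datatype initial = f3 | f2

fun initial_width :: "initial \<Rightarrow> nat" where
  "initial_width f3 = 2"
| "initial_width f2 = 1"

fun initial_value :: "(nat \<Rightarrow> int) \<Rightarrow> initial \<Rightarrow> laurent" where
  "initial_value \<epsilon> f3 = T3_bracket 3 \<epsilon>"
| "initial_value \<epsilon> f2 = entry_value f2pm (\<epsilon> 1)"

type_synonym summand = "initial \<times> symbol list"

fun summand_value :: "(nat \<Rightarrow> int) \<Rightarrow> summand \<Rightarrow> laurent" where
  "summand_value \<epsilon> (i, w) = initial_value \<epsilon> i * word_value \<epsilon> (Suc (initial_width i)) w"

definition expr_value :: "(nat \<Rightarrow> int) \<Rightarrow> summand multiset \<Rightarrow> laurent" where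
  "expr_value \<epsilon> M = (\<Sum>t \<in># M. summand_value \<epsilon> t)"


section \<open>The recursion rules\<close>

text \<open>The rules (A), (f) and (C), according to the last symbol of a summand. No summand that
  arises consists of the initial symbol alone.\<close>

fun apply_rule :: "summand \<Rightarrow> summand multiset" where
  "apply_rule (i, w) =
     (case last w of
        V \<Rightarrow> {# (i, butlast w @ [C]) #}
      | H \<Rightarrow> {# (i, butlast w @ [H, V]) #}
      | C \<Rightarrow> {# (i, butlast w @ [C, V]), (i, butlast w @ [V, H]) #})"

definition apply_rules :: "summand multiset \<Rightarrow> summand multiset" where
  "apply_rules M = (\<Sum>t \<in># M. apply_rule t)"


section \<open>Substituting C from the left\<close>

text \<open>A substitution of C replaces two summands that differ only in that one has \<open>[V, V]\<close> where
  the other has \<open>H\<close>. It takes place at \<open>k\<close> if \<open>k\<close> crossings precede the replaced block.\<close>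

inductive subst_C_at :: "nat \<Rightarrow> summand multiset \<Rightarrow> summand multiset \<Rightarrow> bool" where
  "subst_C_at (initial_width i + sum_list (map width p))
     (M + {# (i, p @ [V, V] @ s), (i, p @ [H] @ s) #})
     (M + {# (i, p @ [C] @ s) #})"

definition subst_C_leftmost :: "summand multiset \<Rightarrow> summand multiset \<Rightarrow> bool" where
  "subst_C_leftmost M N \<longleftrightarrow>
     (\<exists>k. subst_C_at k M N \<and> (\<forall>j < k. \<nexists>N'. subst_C_at j M N'))"

definition C_substituted_from_left :: "summand multiset \<Rightarrow> summand multiset \<Rightarrow> bool" where
  "C_substituted_from_left M N \<longleftrightarrow>
     subst_C_leftmost\<^sup>*\<^sup>* M N \<and> (\<nexists>k N'. subst_C_at k N N')"

text \<open>Multiplying out all occurrences of \<open>C = [V, V] + H\<close>.\<close>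

fun unfold_word :: "symbol list \<Rightarrow> symbol list multiset" where
  "unfold_word [] = {# [] #}"
| "unfold_word (V # w) = image_mset (\<lambda>u. V # u) (unfold_word w)"
| "unfold_word (H # w) = image_mset (\<lambda>u. H # u) (unfold_word w)"
| "unfold_word (C # w) =
     image_mset (\<lambda>u. V # V # u) (unfold_word w) + image_mset (\<lambda>u. H # u) (unfold_word w)"

definition unfold_C :: "summand multiset \<Rightarrow> summand multiset" where
  "unfold_C M = (\<Sum>(i, w) \<in># M. image_mset (Pair i) (unfold_word w))"

end

theory Submission
  imports Defs
begin

text \<open>
  Expanding the last crossing of T(3,b) gives a three-term recursion. The vertical smoothing leaves
  T(3,b-1); the horizontal one turns the crossing before it into a kink, whose removal leaves T(3,b-2).
  In tuple notation this reads \<open>f\<^sub>b = (f\<^sub>b\<^sub>-\<^sub>1, V) + (f\<^sub>b\<^sub>-\<^sub>2, H)\<close>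
  (\<open>T3_bracket_recursion\<close>). To count components, the left part of the table is cut at a column and
  closed by one of the two planar caps; the strands between two columns are then shrunk by a
  retraction, which preserves the number of components under all further smoothings
  (\<open>kauffman_bracket_retraction\<close>).

  Iterating the recursion down to \<open>f\<^sub>3\<close> and \<open>f\<^sub>2\<close> shows that \<open>f\<^sub>b\<close> is the
  sum over all words in \<open>V\<close> and \<open>H\<close> of the right width, started by \<open>f\<^sub>3\<close> or by
  \<open>f\<^sub>2, H\<close> (\<open>T3_bracket_eq_expr_value\<close>). Substituting \<open>C\<close> at one position after the
  other, from the left, combines the words that start with \<open>V V\<close> and those that start with \<open>H\<close> and
  leaves those that start with \<open>V H\<close>. Hence the final words of width \<open>n\<close>, for \<open>n \<ge> 3\<close>,
  are \<open>C\<close> followed by a final word of width \<open>n - 2\<close>, or \<open>V H\<close> followed by one of width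
  \<open>n - 3\<close> (\<open>C_words\<close>). The rules act on the last symbol of a word and therefore respect this
  decomposition at its start, so they take the final words of width \<open>n\<close> to those of width
  \<open>n + 1\<close> (\<open>apply_rules_C_words\<close>). Thus the expression produced by the rules is the
  result of substituting from the left (\<open>stage_0_leftmost\<close>, \<open>stage_irreducible\<close>), and
  multiplying it out returns the sum over all words (\<open>unfold_C_stage\<close>).
\<close>


section \<open>Components of a gluing relation\<close>

definition linked :: "('e \<times> 'e) set \<Rightarrow> ('e \<times> 'e) set" where
  "linked J = (J \<union> J\<inverse>)\<^sup>*"

lemma linked_refl [simp]: "(a, a) \<in> linked J"
  by (simp add: linked_def)

lemma linked_sym: "(a, b) \<in> linked J \<Longrightarrow> (b, a) \<in> linked J"
  unfolding linked_def by (rule symD[OF sym_rtrancl[OF sym_Un_converse]])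

lemma linked_trans: "(a, b) \<in> linked J \<Longrightarrow> (b, c) \<in> linked J \<Longrightarrow> (a, c) \<in> linked J"
  unfolding linked_def by (rule rtrancl_trans)

lemma linked_base: "(a, b) \<in> J \<Longrightarrow> (a, b) \<in> linked J"
  unfolding linked_def by auto

lemma linked_superset: "J \<subseteq> linked J"
  by (rule subrelI) (rule linked_base)

lemma linked_mono: "J \<subseteq> J' \<Longrightarrow> linked J \<subseteq> linked J'"
  unfolding linked_def by (intro rtrancl_mono) auto

lemma linked_map:
  assumes "(u, v) \<in> linked J'"
    and "\<And>u v. (u, v) \<in> J' \<Longrightarrow> (\<phi> u, \<phi> v) \<in> linked J"
  shows "(\<phi> u, \<phi> v) \<in> linked J"
  using assms(1) unfolding linked_def[of J']
proof (induction rule: rtrancl_induct)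
  case (step y z)
  then have "(\<phi> y, \<phi> z) \<in> linked J"
    using assms(2)[of y z] linked_sym[OF assms(2)[of z y]] by auto
  with step.IH show ?case by (rule linked_trans)
qed simp

lemma equiv_linked: "equiv UNIV (linked J)"
  by (intro equivI refl_onI symI transI)
    (simp_all, erule linked_sym, erule (1) linked_trans)

lemma linked_class_eq: "linked J `` {x} = linked J `` {y} \<longleftrightarrow> (x, y) \<in> linked J"
  by (rule eq_equiv_class_iff[OF equiv_linked]) auto

lemma num_components_linked: "num_components S J = card (S // linked J)"
  by (simp add: num_components_def linked_def)

lemma num_components_pos: "finite S \<Longrightarrow> S \<noteq> {} \<Longrightarrow> num_components S J > 0"
  unfolding num_components_linked quotient_def by (auto simp: card_gt_0_iff)

text \<open>A map that pushes all arcs of a diagram onto a part of it along existing gluings, without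
  identifying components. This makes precise that a piece of arc between two gluings can be shrunk.
  The image of a gluing only has to be linked, not glued, so one retraction can absorb a whole chain
  of arcs.\<close>

definition retraction ::
    "('e \<Rightarrow> 'e) \<Rightarrow> 'e set \<Rightarrow> ('e \<times> 'e) set \<Rightarrow> 'e set \<Rightarrow> ('e \<times> 'e) set \<Rightarrow> bool" where
  "retraction \<phi> S' J' S J \<longleftrightarrow> S \<subseteq> S' \<and> J \<subseteq> linked J'
     \<and> (\<forall>s\<in>S. \<phi> s = s) \<and> (\<forall>s\<in>S'. \<phi> s \<in> S \<and> (s, \<phi> s) \<in> linked J')
     \<and> (\<forall>(u, v)\<in>J'. (\<phi> u, \<phi> v) \<in> linked J)"

lemma linked_idem: "J \<subseteq> linked J' \<Longrightarrow> linked J \<subseteq> linked J'"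
  using linked_map[of _ _ J "\<lambda>x. x" J'] by auto

text \<open>Every class meets the smaller set, because \<open>\<phi>\<close> moves a point inside its class; and points of
  the smaller set are linked upstairs only if they are linked downstairs, because \<open>\<phi>\<close> maps chains of
  gluings to chains and fixes both ends.\<close>

lemma num_components_retraction:
  assumes "retraction \<phi> S' J' S J"
  shows "num_components S' J' = num_components S J"
proof -
  have sub: "linked J \<subseteq> linked J'"
    using assms linked_idem unfolding retraction_def by blast
  have iff: "(x, y) \<in> linked J' \<longleftrightarrow> (x, y) \<in> linked J" if "x \<in> S" "y \<in> S" for x y
  proof
    assume "(x, y) \<in> linked J'"
    then have "(\<phi> x, \<phi> y) \<in> linked J"
      using linked_map[of x y J' \<phi> J] assms unfolding retraction_def by blast
    then show "(x, y) \<in> linked J" using that assms unfolding retraction_def by simp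
  qed (use sub in auto)
  have "S' // linked J' = (\<lambda>x. linked J' `` {x}) ` S'"
    by (auto simp: quotient_def)
  also have "\<dots> = (\<lambda>x. linked J' `` {x}) ` S"
  proof
    show "(\<lambda>x. linked J' `` {x}) ` S' \<subseteq> (\<lambda>x. linked J' `` {x}) ` S"
    proof
      fix c assume "c \<in> (\<lambda>x. linked J' `` {x}) ` S'"
      then obtain x where x: "x \<in> S'" "c = linked J' `` {x}" by auto
      then have "\<phi> x \<in> S" "c = linked J' `` {\<phi> x}"
        using assms unfolding retraction_def by (auto simp: linked_class_eq)
      then show "c \<in> (\<lambda>x. linked J' `` {x}) ` S" by blast
    qed
    show "(\<lambda>x. linked J' `` {x}) ` S \<subseteq> (\<lambda>x. linked J' `` {x}) ` S'"
      using assms unfolding retraction_def by auto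
  qed
  finally have q': "S' // linked J' = (\<lambda>x. linked J' `` {x}) ` S" .
  have q: "S // linked J = (\<lambda>x. linked J `` {x}) ` S"
    by (auto simp: quotient_def)
  define h where "h c = linked J' `` c" for c
  have h: "h (linked J `` {x}) = linked J' `` {x}" for x
    unfolding h_def using sub by (auto intro: linked_trans)
  have "bij_betw h (S // linked J) (S' // linked J')"
    unfolding bij_betw_def q q' inj_on_def
    by (auto simp: h image_image linked_class_eq iff)
  then show ?thesis
    unfolding num_components_linked by (metis bij_betw_same_card)
qed

lemma num_components_isolated:
  assumes "finite S" "a \<notin> S" "J \<subseteq> S \<times> S"
  shows "num_components (insert a S) J = Suc (num_components S J)"
proof -
  have a: "linked J `` {a} = {a}"
  proof -
    have "y = a" if "(a, y) \<in> linked J" for y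
      using that unfolding linked_def
      by (induction rule: rtrancl_induct) (use assms in auto)
    then show ?thesis by auto
  qed
  have q: "T // linked J = (\<lambda>x. linked J `` {x}) ` T" for T
    by (auto simp: quotient_def)
  have "linked J `` {a} \<notin> S // linked J"
  proof
    assume "linked J `` {a} \<in> S // linked J"
    then obtain x where "x \<in> S" "linked J `` {a} = linked J `` {x}" unfolding q by blast
    moreover have "x \<in> linked J `` {x}" by simp
    ultimately show False using a assms(2) by (metis singletonD)
  qed
  moreover have "finite (S // linked J)" using assms(1) by (simp add: q)
  ultimately show ?thesis unfolding num_components_linked by (simp add: q)
qed


section \<open>The bracket under retractions\<close>

definition arcs :: "'e crossing list \<Rightarrow> 'e set" where
  "arcs X = (\<Union>(a, b, c, d)\<in>set X. {a, b, c, d})"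

text \<open>Gluings within the fixed part do not disturb a retraction. Hence smoothing the remaining crossings
  commutes with it, and a retraction before the smoothings preserves the whole bracket.\<close>

lemma retraction_Un:
  assumes "retraction \<phi> S' J' S J" "K \<subseteq> S \<times> S"
  shows "retraction \<phi> S' (J' \<union> K) S (J \<union> K)"
proof -
  have m: "linked J' \<subseteq> linked (J' \<union> K)" "linked J \<subseteq> linked (J \<union> K)"
    by (rule linked_mono, blast)+
  show ?thesis
    unfolding retraction_def
  proof (intro conjI)
    show "J \<union> K \<subseteq> linked (J' \<union> K)"
    proof (rule Un_least)
      show "J \<subseteq> linked (J' \<union> K)"
        using assms(1) m(1) unfolding retraction_def by (meson order_trans)
      show "K \<subseteq> linked (J' \<union> K)"
        by (rule subrelI) (simp add: linked_base)
    qed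
    have fixed: "(u, v) \<in> K \<Longrightarrow> \<phi> u = u \<and> \<phi> v = v" for u v
      using assms unfolding retraction_def by blast
    show "\<forall>(u, v)\<in>J' \<union> K. (\<phi> u, \<phi> v) \<in> linked (J \<union> K)"
    proof safe
      fix u v assume "(u, v) \<in> J'"
      then have "(\<phi> u, \<phi> v) \<in> linked J"
        using assms(1) unfolding retraction_def by blast
      then show "(\<phi> u, \<phi> v) \<in> linked (J \<union> K)"
        by (rule subsetD[OF m(2)])
    next
      fix u v assume "(u, v) \<in> K"
      then show "(\<phi> u, \<phi> v) \<in> linked (J \<union> K)"
        using fixed[of u v] linked_base[of u v "J \<union> K"] by simp
    qed
    show "\<forall>s\<in>S'. \<phi> s \<in> S \<and> (s, \<phi> s) \<in> linked (J' \<union> K)"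
      using assms(1) subsetD[OF m(1)] unfolding retraction_def by simp
    show "S \<subseteq> S'" "\<forall>s\<in>S. \<phi> s = s"
      using assms(1) unfolding retraction_def by blast+
  qed
qed

lemma kauffman_bracket_retraction:
  assumes "retraction \<phi> S' J' S J" "arcs X \<subseteq> S"
  shows "kauffman_bracket S' J' X = kauffman_bracket S J X"
  using assms
proof (induction S J X arbitrary: J' rule: kauffman_bracket.induct)
  case (2 S J a b c d X)
  have arcs: "{a, b, c, d} \<subseteq> S" "arcs X \<subseteq> S"
    using "2.prems"(2) by (auto simp: arcs_def)
  then have "retraction \<phi> S' (J' \<union> {(a, b), (c, d)}) S (J \<union> {(a, b), (c, d)})"
    and "retraction \<phi> S' (J' \<union> {(b, c), (d, a)}) S (J \<union> {(b, c), (d, a)})"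
    by (intro retraction_Un[OF "2.prems"(1)]; blast)+
  then show ?case
    by (simp only: kauffman_bracket.simps "2.IH"(1)[OF _ arcs(2)] "2.IH"(2)[OF _ arcs(2)])
qed (simp add: num_components_retraction)

lemma kauffman_bracket_undirected:
  assumes "J' \<union> J'\<inverse> = J \<union> J\<inverse>"
  shows "kauffman_bracket S J' X = kauffman_bracket S J X"
  using assms
proof (induction S J X arbitrary: J' rule: kauffman_bracket.induct)
  case (2 S J a b c d X)
  have e: "(J' \<union> K) \<union> (J' \<union> K)\<inverse> = (J \<union> K) \<union> (J \<union> K)\<inverse>" for K
  proof -
    have "(L \<union> K) \<union> (L \<union> K)\<inverse> = (L \<union> L\<inverse>) \<union> (K \<union> K\<inverse>)" for L
      by blast
    then show ?thesis by (simp only: 2(3))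
  qed
  show ?case unfolding kauffman_bracket.simps 2(1)[OF e] 2(2)[OF e] ..
qed (simp only: kauffman_bracket.simps num_components_def)

text \<open>The rule \<open>\<langle>U \<squnion> L\<rangle> = \<delta> \<langle>L\<rangle>\<close>; since \<open>S\<close> is nonempty, the truncated
  exponent \<open>n - 1\<close> really goes up by one.\<close>

lemma kauffman_bracket_isolated:
  assumes "finite S" "S \<noteq> {}" "a \<notin> S" "J \<subseteq> S \<times> S" "arcs X \<subseteq> S"
  shows "kauffman_bracket (insert a S) J X = loop_value * kauffman_bracket S J X"
  using assms
proof (induction S J X rule: kauffman_bracket.induct)
  case (1 S J)
  then show ?case
    using num_components_pos[of S J] num_components_isolated[of S a J]
    by (cases "num_components S J") auto
next
  case (2 S J a' b' c' d' X)
  have arcs: "{a', b', c', d'} \<subseteq> S" "arcs X \<subseteq> S"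
    using "2.prems"(5) by (auto simp: arcs_def)
  then have J: "J \<union> {(a', b'), (c', d')} \<subseteq> S \<times> S" "J \<union> {(b', c'), (d', a')} \<subseteq> S \<times> S"
    using "2.prems"(4) by blast+
  show ?case
    unfolding kauffman_bracket.simps "2.IH"(1)[OF "2.prems"(1-3) J(1) arcs(2)]
      "2.IH"(2)[OF "2.prems"(1-3) J(2) arcs(2)]
    by (simp only: distrib_left mult.left_commute)
qed

text \<open>The bracket is defined by expanding the first crossing of the list. As the order of the
  smoothings is immaterial, the last crossing, at the right end of the table, may be expanded
  instead.\<close>

lemma kauffman_bracket_snoc:
  "kauffman_bracket S J (X @ [(a, b, c, d)]) =
     A_pow 1 * kauffman_bracket S (J \<union> {(a, b), (c, d)}) X
   + A_pow (- 1) * kauffman_bracket S (J \<union> {(b, c), (d, a)}) X"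
proof (induction S J X rule: kauffman_bracket.induct)
  case (2 S J a' b' c' d' X)
  have swap: "J \<union> K \<union> L = J \<union> L \<union> K" for K L by blast
  show ?case
    unfolding append_Cons kauffman_bracket.simps 2
      swap[of "{(a, b), (c, d)}"] swap[of "{(b, c), (d, a)}"]
    by (simp add: algebra_simps del: Un_insert_left Un_insert_right)
qed simp


section \<open>Cutting the table at a column\<close>

text \<open>The crossing in column \<open>x\<close> involves the middle row and one outer row of the neighbouring squares;
  in the other outer row, \<open>wall_row x\<close>, the trajectory is reflected at the wall. The wall row
  alternates, so the crossing in column \<open>Suc x\<close> involves the rows \<open>1\<close> and \<open>wall_row x\<close>.\<close>

definition wall_row :: "nat \<Rightarrow> nat" where
  "wall_row x = (if odd x then 2 else 0)"

text \<open>The reflections at the left, bottom and top walls up to column \<open>x\<close>. With them the left part of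
  the table has four loose ends: the corner arc \<open>(0, 0)\<close> and the three arcs of column \<open>x\<close>.\<close>

fun wall_links :: "nat \<Rightarrow> ((nat \<times> nat) \<times> (nat \<times> nat)) set" where
  "wall_links 0 = {((0, 1), (0, 2))}"
| "wall_links (Suc x) =
     insert ((x, wall_row (Suc x)), (Suc x, wall_row (Suc x))) (wall_links x)"

text \<open>One of the two planar ways (\<open>q = 0\<close> or \<open>q = 2\<close>) to close the left part: the arc in row \<open>q\<close> is
  joined to the corner, the other two arcs to each other.\<close>

definition cap :: "nat \<Rightarrow> nat \<Rightarrow> ((nat \<times> nat) \<times> (nat \<times> nat)) set" where
  "cap x q = {((0, 0), (x, q)), ((x, 1), (x, 2 - q))}"

text \<open>The smoothings are indexed by the column of squares to the left of the crossing, which itself lies in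
  column \<open>Suc x\<close>.\<close>

definition vertical :: "nat \<Rightarrow> ((nat \<times> nat) \<times> (nat \<times> nat)) set" where
  "vertical x = {((x, 1), (x, wall_row x)), ((Suc x, 1), (Suc x, wall_row x))}"

definition horizontal :: "nat \<Rightarrow> ((nat \<times> nat) \<times> (nat \<times> nat)) set" where
  "horizontal x = {((x, 1), (Suc x, 1)), ((x, wall_row x), (Suc x, wall_row x))}"

definition crossings :: "(nat \<Rightarrow> int) \<Rightarrow> nat \<Rightarrow> (nat \<times> nat) crossing list" where
  "crossings \<epsilon> x = map (column_crossing \<epsilon>) [1..<Suc x]"

definition capped_bracket :: "(nat \<Rightarrow> int) \<Rightarrow> nat \<Rightarrow> nat \<Rightarrow> laurent" where
  "capped_bracket \<epsilon> x q =
     kauffman_bracket (segments (Suc x)) (wall_links x \<union> cap x q) (crossings \<epsilon> x)"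

lemma wall_links_subset: "wall_links x \<subseteq> segments (Suc x) \<times> segments (Suc x)"
  by (induction x) (auto simp: segments_def wall_row_def)

lemma arcs_crossings: "arcs (crossings \<epsilon> x) \<subseteq> segments (Suc x)"
proof -
  have "{a, b, c, d} \<subseteq> segments (Suc x)"
    if "y \<in> {1..<Suc x}" "column_crossing \<epsilon> y = (a, b, c, d)" for a b c d y
    using that by (cases "odd y"; cases "\<epsilon> y = 1")
      (auto simp: column_crossing_def Let_def segments_def)
  then have "(case column_crossing \<epsilon> y of (a, b, c, d) \<Rightarrow> {a, b, c, d}) \<subseteq> segments (Suc x)"
    if "y \<in> {1..<Suc x}" for y
    using that by (cases "column_crossing \<epsilon> y") (simp only: prod.case)
  then show ?thesis
    unfolding arcs_def crossings_def set_map set_upt image_image by (intro UN_least) auto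
qed

text \<open>For either sign the over/under data of the crossing turn into the weight \<open>A\<^sup>\<epsilon>\<close> of the
  smoothing \<open>)(\<close>, up to the direction in which arcs are glued.\<close>

lemma kauffman_bracket_expand_last:
  assumes "\<epsilon> (Suc x) \<in> {1, - 1}"
  shows "kauffman_bracket S J (crossings \<epsilon> (Suc x)) =
      A_pow (\<epsilon> (Suc x)) * kauffman_bracket S (J \<union> vertical x) (crossings \<epsilon> x)
    + A_pow (- \<epsilon> (Suc x)) * kauffman_bracket S (J \<union> horizontal x) (crossings \<epsilon> x)"
proof -
  let ?X = "crossings \<epsilon> x"
  obtain a b c d where c: "column_crossing \<epsilon> (Suc x) = (a, b, c, d)" by (metis prod_cases4)
  have X: "crossings \<epsilon> (Suc x) = ?X @ [(a, b, c, d)]"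
    by (simp add: crossings_def c)
  let ?g = "{(a, b), (c, d)}" and ?h = "{(b, c), (d, a)}"
  let ?V = "if \<epsilon> (Suc x) = 1 then ?g else ?h" and ?H = "if \<epsilon> (Suc x) = 1 then ?h else ?g"
  have "?V \<union> ?V\<inverse> = vertical x \<union> (vertical x)\<inverse>"
    using c assms by (cases "odd x"; cases "\<epsilon> (Suc x) = 1")
      (auto simp: column_crossing_def Let_def vertical_def wall_row_def converse_Un)
  then have V: "kauffman_bracket S (J \<union> ?V) ?X = kauffman_bracket S (J \<union> vertical x) ?X"
    by (intro kauffman_bracket_undirected) (simp only: converse_Un, blast)
  have "?H \<union> ?H\<inverse> = horizontal x \<union> (horizontal x)\<inverse>"
    using c assms by (cases "odd x"; cases "\<epsilon> (Suc x) = 1")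
      (auto simp: column_crossing_def Let_def horizontal_def wall_row_def converse_Un)
  then have H: "kauffman_bracket S (J \<union> ?H) ?X = kauffman_bracket S (J \<union> horizontal x) ?X"
    by (intro kauffman_bracket_undirected) (simp only: converse_Un, blast)
  show ?thesis
    using assms unfolding X kauffman_bracket_snoc V[symmetric] H[symmetric]
    by (auto simp: add.commute)
qed

lemma wall_row_cases: "wall_row x = 0 \<and> wall_row (Suc x) = 2 \<or> wall_row x = 2 \<and> wall_row (Suc x) = 0"
  by (auto simp: wall_row_def)

lemma less_three_iff: "j < (3::nat) \<longleftrightarrow> j = 0 \<or> j = 1 \<or> j = 2"
  by auto

text \<open>Three parallel strands lead from column \<open>x\<close> to the cap; they are shrunk row by row.\<close>

lemma horizontal_smoothing:
  assumes "q \<in> {0, 2}"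
  shows "kauffman_bracket (segments (Suc (Suc x)))
      (wall_links (Suc x) \<union> cap (Suc x) q \<union> horizontal x) (crossings \<epsilon> x)
    = capped_bracket \<epsilon> x q"
  unfolding capped_bracket_def
proof (rule kauffman_bracket_retraction[OF _ arcs_crossings])
  let ?J = "wall_links (Suc x) \<union> cap (Suc x) q \<union> horizontal x"
  have row: "((x, j), (Suc x, j)) \<in> linked ?J" if "j < 3" for j
    using that wall_row_cases[of x]
    by (intro linked_base) (auto simp: less_three_iff horizontal_def)
  have row': "((Suc x, j), (x, j)) \<in> linked ?J" if "j < 3" for j
    using linked_sym[OF row[OF that]] .
  have c1: "((0, 0), (Suc x, q)) \<in> linked ?J" and c2: "((Suc x, 1), (Suc x, 2 - q)) \<in> linked ?J"
    by (auto intro!: linked_base simp: cap_def)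
  have d1: "((0, 0), (x, q)) \<in> linked ?J"
    using linked_trans[OF c1 row'[of q]] assms by auto
  have d2: "((x, 1), (x, 2 - q)) \<in> linked ?J"
    using linked_trans[OF linked_trans[OF row[of 1] c2] row'[of "2 - q"]] assms by auto
  show "retraction (\<lambda>(i, j). (min i x, j)) (segments (Suc (Suc x))) ?J
      (segments (Suc x)) (wall_links x \<union> cap x q)"
    unfolding retraction_def
  proof (intro conjI)
    show "segments (Suc x) \<subseteq> segments (Suc (Suc x))" by (auto simp: segments_def)
    show "wall_links x \<union> cap x q \<subseteq> linked ?J"
      using d1 d2 by (auto intro: linked_base simp: cap_def)
    show "\<forall>s\<in>segments (Suc x). (case s of (i, j) \<Rightarrow> (min i x, j)) = s"
      by (auto simp: segments_def)
    show "\<forall>s\<in>segments (Suc (Suc x)). (case s of (i, j) \<Rightarrow> (min i x, j)) \<in> segments (Suc x)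
        \<and> (s, case s of (i, j) \<Rightarrow> (min i x, j)) \<in> linked ?J"
      using row' by (auto simp: segments_def min_def le_Suc_eq less_Suc_eq)
    show "\<forall>(u, v)\<in>?J. (case u of (i, j) \<Rightarrow> (min i x, j), case v of (i, j) \<Rightarrow> (min i x, j))
        \<in> linked (wall_links x \<union> cap x q)"
      using wall_links_subset[of x]
      by (auto simp: cap_def horizontal_def segments_def min_absorb1 intro!: linked_base)
  qed
qed

text \<open>The cap joins the corner to the outer row of the crossing and the middle row to the wall row. After
  the smoothing, the three arcs of column \<open>Suc x\<close> form one strand from the corner to the wall row
  of column \<open>x\<close>, onto which they are shrunk.\<close>

lemma vertical_smoothing:
  "kauffman_bracket (segments (Suc (Suc x)))
      (wall_links (Suc x) \<union> cap (Suc x) (wall_row x) \<union> vertical x) (crossings \<epsilon> x)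
    = capped_bracket \<epsilon> x (wall_row (Suc x))"
  unfolding capped_bracket_def
proof (rule kauffman_bracket_retraction[OF _ arcs_crossings])
  let ?r = "wall_row x" and ?r' = "wall_row (Suc x)"
  let ?J = "wall_links (Suc x) \<union> cap (Suc x) ?r \<union> vertical x"
  let ?\<phi> = "\<lambda>(i, j). if i = Suc x then (x, ?r') else (i, j)"
  have a: "((Suc x, ?r'), (x, ?r')) \<in> linked ?J"
    by (intro linked_sym[OF linked_base]) simp
  have b: "((Suc x, 1), (Suc x, ?r')) \<in> linked ?J"
    using wall_row_cases[of x] by (intro linked_base) (auto simp: cap_def)
  have c: "((Suc x, ?r), (Suc x, 1)) \<in> linked ?J"
    by (intro linked_sym[OF linked_base]) (auto simp: vertical_def)
  have d: "((0, 0), (Suc x, ?r)) \<in> linked ?J"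
    by (intro linked_base) (auto simp: cap_def)
  have ba: "((Suc x, 1), (x, ?r')) \<in> linked ?J" using b a by (rule linked_trans)
  have cba: "((Suc x, ?r), (x, ?r')) \<in> linked ?J" using c ba by (rule linked_trans)
  have col: "((Suc x, j), (x, ?r')) \<in> linked ?J" if "j < 3" for j
    using that wall_row_cases[of x] a ba cba by (auto simp: less_three_iff)
  show "retraction ?\<phi> (segments (Suc (Suc x))) ?J (segments (Suc x)) (wall_links x \<union> cap x ?r')"
    unfolding retraction_def
  proof (intro conjI)
    show "segments (Suc x) \<subseteq> segments (Suc (Suc x))" by (auto simp: segments_def)
    have "((x, 1), (x, 2 - ?r')) \<in> linked ?J"
      using wall_row_cases[of x] by (intro linked_base) (auto simp: vertical_def)
    moreover have "((0, 0), (x, ?r')) \<in> linked ?J" using d cba by (rule linked_trans)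
    ultimately show "wall_links x \<union> cap x ?r' \<subseteq> linked ?J"
      by (auto intro: linked_base simp: cap_def)
    show "\<forall>s\<in>segments (Suc x). ?\<phi> s = s"
      by (auto simp: segments_def)
    show "\<forall>s\<in>segments (Suc (Suc x)). ?\<phi> s \<in> segments (Suc x) \<and> (s, ?\<phi> s) \<in> linked ?J"
      using col by (auto simp: segments_def less_Suc_eq wall_row_def)
    show "\<forall>(u, v)\<in>?J. (?\<phi> u, ?\<phi> v) \<in> linked (wall_links x \<union> cap x ?r')"
      using wall_links_subset[of x] wall_row_cases[of x]
      by (auto simp: cap_def vertical_def segments_def intro!: linked_base)
  qed
qed

text \<open>For the other cap, the middle arc and the outer arc of the crossing close up to a separate circle,
  while the wall row is joined to the corner.\<close>

lemma vertical_smoothing_loop: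
  "kauffman_bracket (segments (Suc (Suc x)))
      (wall_links (Suc x) \<union> cap (Suc x) (wall_row (Suc x)) \<union> vertical x) (crossings \<epsilon> x)
    = loop_value * capped_bracket \<epsilon> x (wall_row (Suc x))"
proof -
  let ?r = "wall_row x" and ?r' = "wall_row (Suc x)"
  let ?J = "wall_links (Suc x) \<union> cap (Suc x) ?r' \<union> vertical x"
  let ?K = "wall_links x \<union> cap x ?r'"
  let ?S = "segments (Suc x)"
  \<comment> \<open>The circle is shrunk to its outer arc, which is left as an isolated point.\<close>
  let ?\<phi> = "\<lambda>(i, j). if i = Suc x then (if j = ?r' then (x, ?r') else (Suc x, ?r)) else (i, j)"
  have a: "((Suc x, ?r'), (x, ?r')) \<in> linked ?J"
    by (intro linked_sym[OF linked_base]) simp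
  have c: "((Suc x, 1), (Suc x, ?r)) \<in> linked ?J"
    by (intro linked_base) (auto simp: vertical_def)
  have d: "((0, 0), (Suc x, ?r')) \<in> linked ?J"
    by (intro linked_base) (auto simp: cap_def)
  have "kauffman_bracket (segments (Suc (Suc x))) ?J (crossings \<epsilon> x)
      = kauffman_bracket (insert (Suc x, ?r) ?S) ?K (crossings \<epsilon> x)"
  proof (rule kauffman_bracket_retraction)
    show "arcs (crossings \<epsilon> x) \<subseteq> insert (Suc x, ?r) ?S" using arcs_crossings by blast
    show "retraction ?\<phi> (segments (Suc (Suc x))) ?J (insert (Suc x, ?r) ?S) ?K"
      unfolding retraction_def
    proof (intro conjI)
      show "insert (Suc x, ?r) ?S \<subseteq> segments (Suc (Suc x))"
        by (auto simp: segments_def wall_row_def)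
      have "((x, 1), (x, 2 - ?r')) \<in> linked ?J"
        using wall_row_cases[of x] by (intro linked_base) (auto simp: vertical_def)
      moreover have "((0, 0), (x, ?r')) \<in> linked ?J" using d a by (rule linked_trans)
      ultimately show "?K \<subseteq> linked ?J"
        by (auto intro: linked_base simp: cap_def)
      show "\<forall>s\<in>insert (Suc x, ?r) ?S. ?\<phi> s = s"
        using wall_row_cases[of x] by (auto simp: segments_def)
      show "\<forall>s\<in>segments (Suc (Suc x)). ?\<phi> s \<in> insert (Suc x, ?r) ?S \<and> (s, ?\<phi> s) \<in> linked ?J"
        using a c wall_row_cases[of x]
        by (auto simp: segments_def less_Suc_eq less_three_iff)
      show "\<forall>(u, v)\<in>?J. (?\<phi> u, ?\<phi> v) \<in> linked ?K"
        using wall_links_subset[of x] wall_row_cases[of x]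
        by (auto simp: cap_def vertical_def segments_def intro!: linked_base)
    qed
  qed
  also have "\<dots> = loop_value * kauffman_bracket ?S ?K (crossings \<epsilon> x)"
    by (rule kauffman_bracket_isolated)
      (use wall_links_subset[of x] wall_row_cases[of x] arcs_crossings in
        \<open>auto simp: segments_def cap_def\<close>)
  finally show ?thesis by (simp add: capped_bracket_def)
qed

lemma A_pow_mult: "A_pow i * A_pow j = A_pow (i + j)"
  by (simp add: A_pow_def mult_single)

text \<open>Here the cap joins the two right ends of the crossing. The crossing is a kink, removed by the first
  Reidemeister move at the price \<open>A\<^sup>\<epsilon> \<delta> + A\<^sup>-\<^sup>\<epsilon> = - A\<^sup>3\<^sup>\<epsilon>\<close>.\<close>

lemma capped_bracket_Suc_kink:
  assumes "\<epsilon> (Suc x) \<in> {1, - 1}"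
  shows "capped_bracket \<epsilon> (Suc x) (wall_row (Suc x)) =
    - A_pow (3 * \<epsilon> (Suc x)) * capped_bracket \<epsilon> x (wall_row (Suc x))"
proof -
  let ?e = "\<epsilon> (Suc x)"
  have q: "wall_row (Suc x) \<in> {0, 2}" by (simp add: wall_row_def)
  have "A_pow ?e * loop_value + A_pow (- ?e) = - A_pow (3 * ?e)"
    using assms by (auto simp: loop_value_def algebra_simps A_pow_mult)
  then show ?thesis
    unfolding capped_bracket_def[of _ "Suc x"]
    unfolding kauffman_bracket_expand_last[of \<epsilon> x, OF assms] vertical_smoothing_loop
      horizontal_smoothing[OF q]
    by (metis distrib_right mult.assoc)
qed

lemma capped_bracket_Suc:
  assumes "\<epsilon> (Suc x) \<in> {1, - 1}"
  shows "capped_bracket \<epsilon> (Suc x) (wall_row x) =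
      A_pow (\<epsilon> (Suc x)) * capped_bracket \<epsilon> x (wall_row (Suc x))
    + A_pow (- \<epsilon> (Suc x)) * capped_bracket \<epsilon> x (wall_row x)"
proof -
  have q: "wall_row x \<in> {0, 2}" by (simp add: wall_row_def)
  show ?thesis
    unfolding capped_bracket_def[of _ "Suc x"]
    unfolding kauffman_bracket_expand_last[of \<epsilon> x, OF assms] vertical_smoothing
      horizontal_smoothing[OF q] ..
qed


section \<open>The recursion for T(3,b)\<close>

lemma wall_links_eq:
  "wall_links x = insert ((0, 1), (0, 2))
     {((y, wall_row (Suc y)), (Suc y, wall_row (Suc y))) | y. y < x}"
  by (induction x) (auto simp: less_Suc_eq)

lemma wall_linksI:
  "y < x \<Longrightarrow> ((y, wall_row (Suc y)), (Suc y, wall_row (Suc y))) \<in> wall_links x"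
  by (auto simp: wall_links_eq)

lemma linked_wall_row:
  assumes "a \<in> {i, Suc i}" "a \<in> {i', Suc i'}" "i \<le> x" "i' \<le> x" "wall_links x \<subseteq> J"
  shows "((i, wall_row a), (i', wall_row a)) \<in> linked J"
proof -
  consider "i = i'" | "i' = Suc i" "a = Suc i" | "i = Suc i'" "a = Suc i'"
    using assms(1,2) by auto
  then show ?thesis
  proof cases
    case 2
    then show ?thesis
      using wall_linksI[of i x] assms(4,5) by (intro linked_base) auto
  next
    case 3
    then show ?thesis
      using wall_linksI[of i' x] assms(3,5) by (intro linked_sym[OF linked_base]) auto
  qed simp
qed

text \<open>Each joint sits at a point on the top or bottom wall, at \<open>(0, 2)\<close>, on the right wall, or at a
  corner. Joints may also glue an arc to itself and occur in both directions, so they agree with the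
  explicit links only up to linkage.\<close>

lemma joints_subset_linked:
  fixes x :: nat
  defines "J \<equiv> wall_links x \<union> cap x (wall_row (Suc x))"
  shows "joints (Suc x) \<subseteq> linked J"
proof (rule subrelI)
  let ?q = "wall_row (Suc x)"
  fix s t assume "(s, t) \<in> joints (Suc x)"
  then consider
      (wall) a c where "s \<in> segments (Suc x)" "t \<in> segments (Suc x)"
        "(a, c) \<in> seg_ends s" "(a, c) \<in> seg_ends t" "on_wall (Suc x) (a, c)"
    | (corner) p q where "s \<in> segments (Suc x)" "t \<in> segments (Suc x)"
        "p \<in> seg_ends s" "is_corner (Suc x) p" "q \<in> seg_ends t" "is_corner (Suc x) q"
    unfolding joints_def by fastforce
  then show "(s, t) \<in> linked J"
  proof cases
    case wall
    obtain i j i' j' where st: "s = (i, j)" "t = (i', j')" by (metis surj_pair)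
    have ij: "i \<le> x" "i' \<le> x" "j < 3" "j' < 3" "a \<in> {i, Suc i}" "a \<in> {i', Suc i'}"
      "c \<in> {j, Suc j}" "c \<in> {j', Suc j'}" "even (a + c)"
      using wall(1-4) by (auto simp: st segments_def seg_ends_def)
    have sub: "wall_links x \<subseteq> J" by (simp add: J_def)
    consider "c = 0" | "c = 3" | "c \<in> {1, 2}" "a = 0" | "c \<in> {1, 2}" "a = Suc x"
    proof -
      have "c = 0 \<or> c = 1 \<or> c = 2 \<or> c = 3" using ij by auto
      moreover have "a = 0 \<or> a = Suc x \<or> c = 0 \<or> c = 3"
        using wall(5) by (auto simp: on_wall_def)
      ultimately show ?thesis using that by blast
    qed
    then show ?thesis
    proof cases
      case 1
      then have "j = wall_row a" "j' = wall_row a" using ij by (auto simp: wall_row_def)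
      then show ?thesis unfolding st using linked_wall_row ij sub by metis
    next
      case 2
      then have "j = wall_row a" "j' = wall_row a" using ij by (auto simp: wall_row_def)
      then show ?thesis unfolding st using linked_wall_row ij sub by metis
    next
      case 3
      then have c: "c = 2" using ij by auto
      have "((0, 1), (0, 2)) \<in> J" by (auto simp: J_def wall_links_eq)
      then have "((0, 1), (0, 2)) \<in> linked J" "((0, 2), (0, 1)) \<in> linked J"
        using linked_base linked_sym by metis+
      moreover have "i = 0" "i' = 0" "j = 1 \<or> j = 2" "j' = 1 \<or> j' = 2"
        using ij 3 c by auto
      ultimately show ?thesis unfolding st by auto
    next
      case 4
      have "((x, 1), (x, 2 - ?q)) \<in> J" by (auto simp: J_def cap_def)
      then have "((x, 1), (x, 2 - ?q)) \<in> linked J" "((x, 2 - ?q), (x, 1)) \<in> linked J"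
        using linked_base linked_sym by metis+
      moreover have "i = x" "i' = x"
        using ij 4 by auto
      moreover have "j = 1 \<or> j = 2 - ?q" "j' = 1 \<or> j' = 2 - ?q"
        using ij 4 by (auto simp: wall_row_def)
      ultimately show ?thesis unfolding st by auto
    qed
  next
    case corner
    have ends: "r = (0, 0) \<or> r = (x, ?q)"
      if "r \<in> segments (Suc x)" "p \<in> seg_ends r" "is_corner (Suc x) p" for r p
    proof -
      obtain i j a c where "r = (i, j)" "p = (a, c)" by (metis surj_pair)
      then show ?thesis
        using that by (auto simp: segments_def seg_ends_def is_corner_def wall_row_def)
    qed
    have "((0, 0), (x, ?q)) \<in> J" by (auto simp: J_def cap_def)
    then have "((0, 0), (x, ?q)) \<in> linked J" "((x, ?q), (0, 0)) \<in> linked J"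
      using linked_base linked_sym by metis+
    then show ?thesis
      using ends[OF corner(1,3,4)] ends[OF corner(2,5,6)] by auto
  qed
qed

lemma links_subset_joints: "wall_links x \<union> cap x (wall_row (Suc x)) \<subseteq> joints (Suc x)"
proof -
  let ?q = "wall_row (Suc x)"
  have wall: "(s, t) \<in> joints (Suc x)"
    if "s \<in> segments (Suc x)" "t \<in> segments (Suc x)" "p \<in> seg_ends s" "p \<in> seg_ends t"
      "on_wall (Suc x) p" for s t p
    using that unfolding joints_def by blast
  have "((0, 1), (0, 2)) \<in> joints (Suc x)"
    by (rule wall[of _ _ "(0, 2)"]) (auto simp: segments_def seg_ends_def on_wall_def)
  moreover have "((y, wall_row (Suc y)), (Suc y, wall_row (Suc y))) \<in> joints (Suc x)"
    if "y < x" for y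
    using that
    by (intro wall[of _ _ "(Suc y, if odd (Suc y) then 3 else 0)"])
      (auto simp: segments_def seg_ends_def on_wall_def wall_row_def)
  moreover have "((x, 1), (x, 2 - ?q)) \<in> joints (Suc x)"
    by (rule wall[of _ _ "(Suc x, if odd (Suc x) then 1 else 2)"])
      (auto simp: segments_def seg_ends_def on_wall_def wall_row_def)
  moreover have "((0, 0), (x, ?q)) \<in> joints (Suc x)"
  proof -
    have "(0, 0) \<in> seg_ends (0, 0)" "is_corner (Suc x) (0, 0)"
      "(Suc x, if odd (Suc x) then 3 else 0) \<in> seg_ends (x, ?q)"
      "is_corner (Suc x) (Suc x, if odd (Suc x) then 3 else 0)"
      "(0, 0) \<in> segments (Suc x)" "(x, ?q) \<in> segments (Suc x)"
      by (auto simp: segments_def seg_ends_def is_corner_def wall_row_def)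
    then show ?thesis unfolding joints_def by blast
  qed
  ultimately show ?thesis unfolding wall_links_eq cap_def by blast
qed

text \<open>The right wall and the outer connection of the two corners form a cap: the long arc ends in the
  right corner with even coordinate sum, and the other two rows are joined by the reflection at the right
  wall.\<close>

lemma T3_bracket_Suc:
  "T3_bracket (Suc x) \<epsilon> = capped_bracket \<epsilon> x (wall_row (Suc x))"
  unfolding T3_bracket_def capped_bracket_def crossings_def[symmetric]
proof (rule kauffman_bracket_retraction[OF _ arcs_crossings])
  show "retraction (\<lambda>s. s) (segments (Suc x)) (joints (Suc x)) (segments (Suc x))
      (wall_links x \<union> cap x (wall_row (Suc x)))"
    using joints_subset_linked[of x] subset_trans[OF links_subset_joints[of x] linked_superset]
    unfolding retraction_def by auto
qed

lemma kauffman_bracket_point: "kauffman_bracket {a} {} [] = 1"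
  using num_components_isolated[of "{}" a "{}"]
  by (simp add: num_components_def quotient_def)

lemma capped_bracket_0:
  "capped_bracket \<epsilon> 0 2 = 1" "capped_bracket \<epsilon> 0 0 = loop_value"
proof -
  have S: "segments (Suc 0) = {(0, 0), (0, 1), (0, 2)}"
    by (auto simp: segments_def less_three_iff)
  let ?J = "wall_links 0 \<union> cap 0 2"
  have J: "((0, 1), (0, 0)) \<in> linked ?J" "((0, 2), (0, 0)) \<in> linked ?J"
    by (rule linked_base, simp add: cap_def,
        rule linked_sym[OF linked_base], simp add: cap_def)
  have "kauffman_bracket (segments (Suc 0)) ?J [] = kauffman_bracket {(0::nat, 0::nat)} {} []"
    by (rule kauffman_bracket_retraction[where \<phi> = "\<lambda>_. (0::nat, 0::nat)"])
      (use J in \<open>auto simp: retraction_def S arcs_def\<close>)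
  then show "capped_bracket \<epsilon> 0 2 = 1"
    by (simp add: capped_bracket_def crossings_def kauffman_bracket_point
        del: kauffman_bracket.simps)
  let ?J = "wall_links 0 \<union> cap 0 0"
  have J: "((0, 2), (0, 1)) \<in> linked ?J"
    by (rule linked_sym[OF linked_base]) simp
  have "kauffman_bracket (segments (Suc 0)) ?J [] = kauffman_bracket (insert (0::nat, 1::nat) {(0, 0)}) {} []"
    by (rule kauffman_bracket_retraction
        [where \<phi> = "\<lambda>(i::nat, j::nat). if j = 0 then (0::nat, 0::nat) else (0, 1)"])
      (use J in \<open>auto simp: retraction_def S arcs_def cap_def\<close>)
  also have "\<dots> = loop_value"
    by (subst kauffman_bracket_isolated)
      (auto simp: arcs_def kauffman_bracket_point simp del: kauffman_bracket.simps)
  finally show "capped_bracket \<epsilon> 0 0 = loop_value"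
    by (simp add: capped_bracket_def crossings_def del: kauffman_bracket.simps)
qed

lemma T3_bracket_1: "T3_bracket 1 \<epsilon> = 1"
  using T3_bracket_Suc[of 0 \<epsilon>] by (simp add: wall_row_def capped_bracket_0)

lemma T3_bracket_2:
  assumes "\<epsilon> 1 \<in> {1, - 1}"
  shows "T3_bracket 2 \<epsilon> = entry_value f2pm (\<epsilon> 1)"
proof -
  have "T3_bracket 2 \<epsilon> = A_pow (\<epsilon> 1) + A_pow (- \<epsilon> 1) * loop_value"
    using T3_bracket_Suc[of 1 \<epsilon>, unfolded Suc_1] capped_bracket_Suc[of \<epsilon> 0] assms
    by (simp add: wall_row_def capped_bracket_0)
  then show ?thesis
    using assms by (auto simp: loop_value_def right_diff_distrib A_pow_mult)
qed

text \<open>The vertical smoothing of the last crossing leaves T(3,b-1). The horizontal one leaves T(3,b-1)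
  with the wrong cap, which makes the preceding crossing a kink in front of T(3,b-2).\<close>

lemma T3_bracket_recursion:
  assumes "\<epsilon> (Suc x) \<in> {1, - 1}" "\<epsilon> (Suc (Suc x)) \<in> {1, - 1}"
  shows "T3_bracket (Suc (Suc (Suc x))) \<epsilon> =
      A_pow (\<epsilon> (Suc (Suc x))) * T3_bracket (Suc (Suc x)) \<epsilon>
    + A_pow (- \<epsilon> (Suc (Suc x))) * (- A_pow (3 * \<epsilon> (Suc x)) * T3_bracket (Suc x) \<epsilon>)"
proof -
  have "wall_row (Suc (Suc (Suc x))) = wall_row (Suc x)" by (simp add: wall_row_def)
  then show ?thesis
    unfolding T3_bracket_Suc
    by (simp only: capped_bracket_Suc[of \<epsilon> "Suc x", OF assms(2)] capped_bracket_Suc_kink[of \<epsilon> x, OF assms(1)])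
qed


section \<open>The summands produced by the rules\<close>

fun VH_words :: "nat \<Rightarrow> symbol list multiset" where
  "VH_words 0 = {# [] #}"
| "VH_words (Suc 0) = {# [V] #}"
| "VH_words (Suc (Suc n)) =
     image_mset ((#) V) (VH_words (Suc n)) + image_mset ((#) H) (VH_words n)"

text \<open>The words of total width \<open>n\<close> after \<open>C\<close> has been substituted at all positions below \<open>k\<close>.
  Substituting at the very start merges the words \<open>V V w\<close> and \<open>H w\<close> into \<open>C w\<close> and leaves the
  words \<open>V H w\<close>; from there on \<open>w\<close> is processed in the same way, two or three positions later.
  For \<open>k = 0\<close> nothing is substituted, for \<open>k \<ge> n\<close> everything is. The truncated subtractions express
  that a position inside the leading block offers nothing to substitute.\<close>

fun C_words :: "nat \<Rightarrow> nat \<Rightarrow> symbol list multiset" where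
  "C_words 0 n = VH_words n"
| "C_words (Suc k) 0 = {# [] #}"
| "C_words (Suc k) (Suc 0) = {# [V] #}"
| "C_words (Suc k) (Suc (Suc 0)) = {# [C] #}"
| "C_words (Suc k) (Suc (Suc (Suc n))) =
     image_mset ((#) C) (C_words (k - 1) (Suc n))
   + image_mset (\<lambda>w. V # H # w) (C_words (k - 2) n)"

text \<open>The expression of width \<open>b - 1\<close> after substitution at all positions below \<open>k\<close>. Words after
  \<open>f3\<close> start at position 2. Those after \<open>f2\<close> start with \<open>H\<close>, since \<open>(f2, V)\<close> is absorbed in
  \<open>f3\<close>, and continue freely from position 3.\<close>

definition stage :: "nat \<Rightarrow> nat \<Rightarrow> summand multiset" where
  "stage b k = image_mset (Pair f3) (C_words (k - 2) (b - 3))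
     + image_mset (\<lambda>w. (f2, H # w)) (C_words (k - 3) (b - 4))"

lemma C_words_saturated: "n \<le> k \<Longrightarrow> C_words k n = C_words n n"
proof (induction k n rule: C_words.induct)
  case (5 k n)
  have "C_words (k - 1) (Suc n) = C_words (Suc n) (Suc n)" "C_words (k - 2) n = C_words n n"
    using 5 by auto
  then show ?case by simp
qed auto

lemma apply_rules_add [simp]: "apply_rules (M + N) = apply_rules M + apply_rules N"
  by (simp add: apply_rules_def)

text \<open>The rules touch only the last symbol, so they act on the part of a word behind a leading \<open>C\<close> or
  \<open>V H\<close>, and the fully substituted words of width \<open>n\<close> become those of width \<open>Suc n\<close>. If nothing
  stands behind the prefix \<open>p\<close>, the last symbol is that of \<open>p\<close>, and only \<open>H\<close> occurs there.\<close>

lemma apply_rules_C_words: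
  assumes "n = 0 \<Longrightarrow> p \<noteq> [] \<and> last p = H"
  shows "apply_rules (image_mset (\<lambda>w. (i, p @ w)) (C_words n n))
    = image_mset (\<lambda>w. (i, p @ w)) (C_words (Suc n) (Suc n))"
  using assms
proof (induction n arbitrary: p rule: less_induct)
  case (less n)
  consider "n = 0" | "n = 1" | "n = 2" | m where "n = Suc (Suc (Suc m))"
    by (metis One_nat_def Suc_1 not0_implies_Suc)
  then show ?case
  proof cases
    case 1
    then obtain q where "p = q @ [H]" using less.prems by (metis append_butlast_last_id)
    with 1 show ?thesis by (simp add: apply_rules_def)
  next
    case 2
    then show ?thesis by (simp add: apply_rules_def butlast_append numeral_2_eq_2)
  next
    case 3
    then show ?thesis by (simp add: apply_rules_def butlast_append numeral_2_eq_2)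
  next
    case 4
    have "apply_rules (image_mset (\<lambda>w. (i, p @ C # w)) (C_words (Suc m) (Suc m)))
        = image_mset (\<lambda>w. (i, p @ C # w)) (C_words (Suc (Suc m)) (Suc (Suc m)))"
      using less.IH[of "Suc m" "p @ [C]"] 4 by simp
    moreover have "apply_rules (image_mset (\<lambda>w. (i, p @ V # H # w)) (C_words m m))
        = image_mset (\<lambda>w. (i, p @ V # H # w)) (C_words (Suc m) (Suc m))"
      using less.IH[of m "p @ [V, H]"] 4 by simp
    ultimately show ?thesis
      using 4 by (simp add: image_mset.compositionality comp_def)
  qed
qed

lemma stage_final:
  "n + 4 \<le> k \<Longrightarrow> stage (n + 4) k = image_mset (Pair f3) (C_words (Suc n) (Suc n))
     + image_mset (\<lambda>w. (f2, H # w)) (C_words n n)"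
  unfolding stage_def
  using C_words_saturated[of "Suc n" "k - 2"] C_words_saturated[of n "k - 3"]
  by (simp add: numeral_eq_Suc)

lemma recursion_stage:
  assumes "F 4 = {# (f3, [V]), (f2, [H]) #}"
    and "\<And>b. b \<ge> 5 \<Longrightarrow> F b = apply_rules (F (b - 1))"
  shows "F (n + 4) = stage (n + 4) (n + 4)"
proof (induction n)
  case 0
  then show ?case using assms(1) stage_final[of 0 4] by simp
next
  case (Suc n)
  have "F (Suc n + 4) = apply_rules (F (n + 4))"
    using assms(2)[of "Suc n + 4"] by (simp add: add.commute)
  also have "\<dots> = stage (Suc n + 4) (Suc n + 4)"
    using apply_rules_C_words[of "Suc n" "[]" f3] apply_rules_C_words[of n "[H]" f2]
    unfolding Suc stage_final[OF order_refl] by simp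
  finally show ?case .
qed


section \<open>Substitution from the left, one position at a time\<close>

text \<open>The words that can occur once all positions below \<open>k\<close> have been processed, whatever has
  happened further to the right.\<close>

inductive C_left :: "nat \<Rightarrow> symbol list \<Rightarrow> bool" where
  start: "C_left 0 w"
| Nil: "C_left k []"
| V: "C_left k [V]"
| C: "C_left (k - 2) w \<Longrightarrow> C_left k (C # w)"
| VH: "C_left (k - 3) w \<Longrightarrow> C_left k (V # H # w)"

lemma C_left_mono: "C_left k w \<Longrightarrow> j \<le> k \<Longrightarrow> C_left j w"
proof (induction arbitrary: j rule: C_left.induct)
  case (C k w)
  then show ?case using C_left.C diff_le_mono by blast
next
  case (VH k w)
  then show ?case using C_left.VH diff_le_mono by blast
qed (auto intro: C_left.intros)

lemma C_left_C_words: "w \<in># C_words k n \<Longrightarrow> C_left k w"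
proof (induction k n arbitrary: w rule: C_words.induct)
  case (5 k n)
  then show ?case
    using C_left.C[of "Suc k"] C_left.VH[of "Suc k"] by (auto simp: numeral_eq_Suc)
next
  case (4 k)
  then show ?case by (auto intro: C_left.C C_left.Nil)
qed (auto intro: C_left.intros)

lemma C_left_tail_C: "C_left k (C # w) \<Longrightarrow> C_left (k - 2) w"
  by (cases rule: C_left.cases) (auto intro: C_left.start)

lemma C_left_tail_VH: "C_left k (V # H # w) \<Longrightarrow> C_left (k - 3) w"
  by (cases rule: C_left.cases) (auto intro: C_left.start)

text \<open>Two such words that agree up to a block \<open>V V\<close> against \<open>H\<close> first differ at position \<open>k\<close> or
  later: within the processed part a leading \<open>V\<close> is followed by \<open>H\<close> (or by nothing) and no block starts with
  \<open>H\<close>.\<close>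

lemma C_left_clash:
  assumes "C_left k (p @ [V, V] @ s)" "C_left k (p @ [H] @ s)"
  shows "k \<le> sum_list (map width p)"
  using assms
proof (induction p arbitrary: k rule: induct_list012)
  case 1
  from 1(2) show ?case by (cases rule: C_left.cases) auto
next
  case (2 a)
  from 2(2) have "C_left k (a # H # s)" by simp
  then show ?case
  proof (cases rule: C_left.cases)
    case C
    then show ?thesis using 2(1) by (auto elim: C_left.cases)
  next
    case VH
    then show ?thesis using 2(1) by (auto elim: C_left.cases)
  qed auto
next
  case (3 a b p)
  from 3(3) have "C_left k (a # b # p @ V # V # s)" by simp
  then show ?case
  proof (cases rule: C_left.cases)
    case C
    moreover from this 3(4) have "C_left (k - 2) ((b # p) @ [H] @ s)"
      using C_left_tail_C[of k "b # p @ [H] @ s"] by simp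
    ultimately show ?thesis using 3(2)[of "k - 2"] by auto
  next
    case VH
    moreover from this 3(4) have "C_left (k - 3) (p @ [H] @ s)"
      using C_left_tail_VH[of k "p @ [H] @ s"] by simp
    ultimately show ?thesis using 3(1)[of "k - 3"] by auto
  qed auto
qed

definition reducible_only_from :: "nat \<Rightarrow> summand set \<Rightarrow> bool" where
  "reducible_only_from k U \<longleftrightarrow> (\<forall>i p s. (i, p @ [V, V] @ s) \<in> U \<longrightarrow> (i, p @ [H] @ s) \<in> U
     \<longrightarrow> k \<le> initial_width i + sum_list (map width p))"

lemma reducible_only_from_subst:
  assumes "reducible_only_from k (set_mset M)" "subst_C_at j M N"
  shows "k \<le> j"
  using assms(2,1) by cases (auto simp: reducible_only_from_def)

lemma reducible_only_from_subset:
  "reducible_only_from k U \<Longrightarrow> T \<subseteq> U \<Longrightarrow> reducible_only_from k T"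
  unfolding reducible_only_from_def by blast

text \<open>A set that contains both \<open>stage b k\<close> and \<open>stage b (Suc k)\<close>, hence also all expressions met on
  the way from one to the other.\<close>

definition stage_summands :: "nat \<Rightarrow> summand set" where
  "stage_summands k = {(f3, w) | w. C_left (k - 2) w} \<union> {(f2, H # w) | w. C_left (k - 3) w}"

lemma reducible_only_from_stage_summands: "reducible_only_from k (stage_summands k)"
  unfolding reducible_only_from_def
proof (intro allI impI)
  fix i p s
  assume VV: "(i, p @ [V, V] @ s) \<in> stage_summands k"
    and H: "(i, p @ [H] @ s) \<in> stage_summands k"
  show "k \<le> initial_width i + sum_list (map width p)"
  proof (cases i)
    case f3
    then show ?thesis
      using VV H C_left_clash[of "k - 2" p s] by (auto simp: stage_summands_def)
  next
    case f2
    then obtain q where "p = H # q"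
      using VV by (cases p) (auto simp: stage_summands_def)
    then show ?thesis
      using f2 VV H C_left_clash[of "k - 3" q s] by (auto simp: stage_summands_def)
  qed
qed

lemma stage_subset: "j \<le> k \<Longrightarrow> set_mset (stage b k) \<subseteq> stage_summands j"
  using C_left_mono[OF C_left_C_words[of _ "k - 2" "b - 3"], of _ "j - 2"]
    C_left_mono[OF C_left_C_words[of _ "k - 3" "b - 4"], of _ "j - 3"]
  unfolding stage_def stage_summands_def by (auto simp: diff_le_mono)

text \<open>Simultaneous substitution at position \<open>k\<close> in disjoint pairs of summands. Unlike chains of leftmost
  steps, it is compatible with sums without any side condition.\<close>

inductive substs_C_at :: "nat \<Rightarrow> summand multiset \<Rightarrow> summand multiset \<Rightarrow> bool" for k where
  none: "substs_C_at k M M"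
| one: "k = initial_width i + sum_list (map width p) \<Longrightarrow>
    substs_C_at k {# (i, p @ [V, V] @ s), (i, p @ [H] @ s) #} {# (i, p @ [C] @ s) #}"
| add: "substs_C_at k M N \<Longrightarrow> substs_C_at k M' N' \<Longrightarrow> substs_C_at k (M + M') (N + N')"

text \<open>The single substitutions are performed one after another. All summands of an intermediate
  expression come from \<open>M\<close>, \<open>N\<close> or \<open>R\<close>, so no substitution further left ever becomes
  possible, and each step is leftmost.\<close>

lemma substs_C_at_leftmost:
  assumes "substs_C_at k M N" "reducible_only_from k (set_mset (M + N + R))"
  shows "subst_C_leftmost\<^sup>*\<^sup>* (M + R) (N + R)"
  using assms
proof (induction arbitrary: R rule: substs_C_at.induct)
  case (one i p s)
  let ?M = "{# (i, p @ [V, V] @ s), (i, p @ [H] @ s) #}" and ?N = "{# (i, p @ [C] @ s) #}"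
  have "subst_C_at k (R + ?M) (R + ?N)"
    unfolding one(1) by (rule subst_C_at.intros)
  moreover have "\<not> subst_C_at j (R + ?M) N'" if "j < k" for j N'
    using reducible_only_from_subst[of k "R + ?M" j N'] that
      reducible_only_from_subset[OF one(2), of "set_mset (R + ?M)"] by auto
  ultimately have "subst_C_leftmost (R + ?M) (R + ?N)"
    unfolding subst_C_leftmost_def by blast
  then show ?case by (simp only: add.commute r_into_rtranclp)
next
  case (add M N M' N')
  have "subst_C_leftmost\<^sup>*\<^sup>* (M + (M' + R)) (N + (M' + R))"
    by (intro add.IH reducible_only_from_subset[OF add.prems]) auto
  moreover have "subst_C_leftmost\<^sup>*\<^sup>* (M' + (N + R)) (N' + (N + R))"
    by (intro add.IH reducible_only_from_subset[OF add.prems]) auto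
  ultimately show ?case by (simp add: ac_simps)
qed simp

lemma substs_C_at_words:
  assumes "k = initial_width i + sum_list (map width p)"
  shows "substs_C_at k
    (image_mset (\<lambda>w. (i, p @ V # V # w)) W + image_mset (\<lambda>w. (i, p @ H # w)) W)
    (image_mset (\<lambda>w. (i, p @ C # w)) W)"
proof (induction W)
  case (add w W)
  from substs_C_at.add[OF substs_C_at.one[OF assms, of w] add] show ?case
    by (simp add: add_mset_commute)
qed (simp add: substs_C_at.none)

text \<open>Either the position is the start of the word, where \<open>V V w\<close> and \<open>H w\<close> are paired off for all
  \<open>w\<close>, or it lies behind the leading block, which joins the prefix \<open>p\<close>.\<close>

lemma substs_C_at_C_words:
  assumes "m = initial_width i + sum_list (map width p) + k"
  shows "substs_C_at m (image_mset (\<lambda>w. (i, p @ w)) (C_words k n))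
    (image_mset (\<lambda>w. (i, p @ w)) (C_words (Suc k) n))"
  using assms
proof (induction k n arbitrary: p rule: C_words.induct)
  case (1 n)
  consider "n = 0" | "n = 1" | "n = 2" | l where "n = Suc (Suc (Suc l))"
    by (metis One_nat_def Suc_1 not0_implies_Suc)
  then show ?case
  proof cases
    case 3
    then show ?thesis
      using substs_C_at_words[of m i p "{#[]#}"] 1 by (simp add: numeral_2_eq_2)
  next
    case 4
    from substs_C_at.add[OF substs_C_at_words[of m i p "VH_words (Suc l)"]
        substs_C_at.none[of m "image_mset (\<lambda>w. (i, p @ V # H # w)) (VH_words l)"]] 1
    show ?thesis
      unfolding 4 by (simp add: image_mset.compositionality comp_def ac_simps)
  qed (auto intro: substs_C_at.none)
next
  case (5 k n)
  have C: "substs_C_at m (image_mset (\<lambda>w. (i, p @ C # w)) (C_words (k - 1) (Suc n)))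
      (image_mset (\<lambda>w. (i, p @ C # w)) (C_words k (Suc n)))"
  proof (cases k)
    case (Suc k')
    then show ?thesis using "5.IH"(1)[of "p @ [C]"] "5.prems" by simp
  qed (simp add: substs_C_at.none)
  have VH: "substs_C_at m (image_mset (\<lambda>w. (i, p @ V # H # w)) (C_words (k - 2) n))
      (image_mset (\<lambda>w. (i, p @ V # H # w)) (C_words (Suc k - 2) n))"
  proof (cases "k \<ge> 2")
    case True
    then have "Suc k - 2 = Suc (k - 2)" by simp
    with True show ?thesis
      using "5.IH"(2)[of "p @ [V, H]"] "5.prems" by (simp del: diff_Suc_Suc)
  next
    case False
    then have "k - 2 = 0" "Suc k - 2 = 0" by auto
    then show ?thesis by (simp only: substs_C_at.none)
  qed
  from substs_C_at.add[OF C VH] show ?case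
    by (simp add: image_mset.compositionality comp_def)
qed (auto intro: substs_C_at.none)

lemma substs_C_at_stage: "substs_C_at k (stage b k) (stage b (Suc k))"
  unfolding stage_def
proof (rule substs_C_at.add)
  show "substs_C_at k (image_mset (Pair f3) (C_words (k - 2) (b - 3)))
      (image_mset (Pair f3) (C_words (Suc k - 2) (b - 3)))"
  proof (cases "k \<ge> 2")
    case True
    then have "Suc k - 2 = Suc (k - 2)" by simp
    with True show ?thesis
      using substs_C_at_C_words[of k f3 "[]" "k - 2" "b - 3"] by simp
  next
    case False
    then have "k - 2 = 0" "Suc k - 2 = 0" by auto
    then show ?thesis by (simp only: substs_C_at.none)
  qed
  show "substs_C_at k (image_mset (\<lambda>w. (f2, H # w)) (C_words (k - 3) (b - 4)))
      (image_mset (\<lambda>w. (f2, H # w)) (C_words (Suc k - 3) (b - 4)))"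
  proof (cases "k \<ge> 3")
    case True
    then have "Suc k - 3 = Suc (k - 3)" by simp
    with True show ?thesis
      using substs_C_at_C_words[of k f2 "[H]" "k - 3" "b - 4"] by simp
  next
    case False
    then have "k - 3 = 0" "Suc k - 3 = 0" by auto
    then show ?thesis by (simp only: substs_C_at.none)
  qed
qed

lemma stage_0_leftmost: "subst_C_leftmost\<^sup>*\<^sup>* (stage b 0) (stage b k)"
proof (induction k)
  case (Suc k)
  have "reducible_only_from k (set_mset (stage b k + stage b (Suc k) + {#}))"
    using stage_subset[of k k b] stage_subset[of k "Suc k" b]
    by (intro reducible_only_from_subset[OF reducible_only_from_stage_summands]) auto
  from substs_C_at_leftmost[OF substs_C_at_stage this] Suc show ?case
    by (auto intro: rtranclp_trans)
qed simp

text \<open>The last stage is also the stage for every larger \<open>k\<close>, so no position offers a substitution.\<close>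

lemma stage_irreducible:
  "\<not> subst_C_at k (stage (n + 4) (n + 4)) N"
proof
  assume "subst_C_at k (stage (n + 4) (n + 4)) N"
  moreover have "stage (n + 4) (n + 4) = stage (n + 4) (n + 4 + Suc k)"
    by (simp only: stage_final[of n "n + 4"] stage_final[of n "n + 4 + Suc k"] le_add1 order_refl)
  moreover have "reducible_only_from (Suc k) (set_mset (stage (n + 4) (n + 4 + Suc k)))"
    using stage_subset[of "Suc k" "n + 4 + Suc k"]
    by (intro reducible_only_from_subset[OF reducible_only_from_stage_summands]) auto
  ultimately show False
    using reducible_only_from_subst[of "Suc k"] by fastforce
qed


section \<open>Multiplying out\<close>

lemma image_mset_sum_mset:
  "(\<Sum>x\<in>#M. image_mset f (g x)) = image_mset f (\<Sum>x\<in>#M. g x)"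
  by (induction M) auto

lemma unfold_VH_words: "(\<Sum>w\<in>#VH_words n. unfold_word w) = VH_words n"
  by (induction n rule: VH_words.induct)
    (simp_all add: image_mset.compositionality comp_def image_mset_sum_mset)

text \<open>Multiplying out undoes the substitutions: \<open>V V w\<close> and \<open>V H w\<close> together make up the words that
  start with \<open>V\<close>.\<close>

lemma unfold_C_words: "(\<Sum>w\<in>#C_words k n. unfold_word w) = VH_words n"
proof (induction k n rule: C_words.induct)
  case (5 k n)
  have "(\<Sum>w\<in>#C_words (Suc k) (Suc (Suc (Suc n))). unfold_word w)
      = image_mset (\<lambda>w. V # V # w) (VH_words (Suc n)) + image_mset ((#) H) (VH_words (Suc n))
      + image_mset (\<lambda>w. V # H # w) (VH_words n)"
    by (simp add: image_mset.compositionality comp_def sum_mset.distrib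
        image_mset_sum_mset flip: 5)
  then show ?case by (simp add: image_mset.compositionality comp_def)
qed (simp_all add: unfold_VH_words)

lemma unfold_C_stage: "unfold_C (stage b k) = stage b 0"
proof -
  have f3: "(\<Sum>w\<in>#C_words j n. image_mset (Pair f3) (unfold_word w))
      = image_mset (Pair f3) (VH_words n)" for j n
    by (simp only: image_mset_sum_mset unfold_C_words)
  have f2: "(\<Sum>w\<in>#C_words j n. image_mset (\<lambda>w. (f2, H # w)) (unfold_word w))
      = image_mset (\<lambda>w. (f2, H # w)) (VH_words n)" for j n
    by (simp only: image_mset_sum_mset unfold_C_words)
  show ?thesis
    by (simp add: unfold_C_def stage_def f3 f2 image_mset.compositionality comp_def)
qed


section \<open>The value of the expression\<close>

lemma word_value_unfold: "(\<Sum>u\<in>#unfold_word w. word_value \<epsilon> k u) = word_value \<epsilon> k w"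
proof (induction w arbitrary: k rule: unfold_word.induct)
  case (4 w)
  have "tuple_value \<epsilon> k [Apm, Apm] = tuple_value \<epsilon> k [Apm] * tuple_value \<epsilon> (Suc k) [Apm]"
    by simp
  with 4 show ?case
    by (simp add: image_mset.compositionality comp_def sum_mset_distrib_left[symmetric]
      distrib_right mult.assoc del: tuple_value.simps)
qed (simp_all add: image_mset.compositionality comp_def sum_mset_distrib_left[symmetric]
      distrib_right mult.assoc del: tuple_value.simps)

lemma expr_value_unfold_C: "expr_value \<epsilon> (unfold_C M) = expr_value \<epsilon> M"
proof (induction M)
  case (add t M)
  obtain i w where "t = (i, w)" by fastforce
  with add show ?case
    by (simp add: expr_value_def unfold_C_def image_mset.compositionality comp_def
        sum_mset_distrib_left[symmetric] word_value_unfold)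
qed (simp add: expr_value_def unfold_C_def)

text \<open>An Euler continuant: it satisfies the same three-term recursion at its left end (from the definition
  of the words) and at its right end (the form taken by the recursion for the bracket).\<close>

definition VH_value :: "(nat \<Rightarrow> int) \<Rightarrow> nat \<Rightarrow> nat \<Rightarrow> laurent" where
  "VH_value \<epsilon> k n = (\<Sum>w\<in>#VH_words n. word_value \<epsilon> k w)"

lemma VH_value_simps:
  "VH_value \<epsilon> k 0 = 1"
  "VH_value \<epsilon> k (Suc 0) = word_value \<epsilon> k [V]"
  "VH_value \<epsilon> k (Suc (Suc n)) = word_value \<epsilon> k [V] * VH_value \<epsilon> (Suc k) (Suc n)
     + word_value \<epsilon> k [H] * VH_value \<epsilon> (k + 2) n"
  by (simp_all add: VH_value_def image_mset.compositionality comp_def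
      sum_mset_distrib_left[symmetric] mult.assoc del: tuple_value.simps)

lemma VH_value_last:
  "VH_value \<epsilon> k (Suc (Suc n)) = word_value \<epsilon> (k + Suc n) [V] * VH_value \<epsilon> k (Suc n)
     + word_value \<epsilon> (k + n) [H] * VH_value \<epsilon> k n"
proof (induction n arbitrary: k rule: induct_nat_012)
  case (ge2 n)
  show ?case
    unfolding VH_value_simps(3)[of \<epsilon> k "Suc (Suc n)"] VH_value_simps(3)[of \<epsilon> k "Suc n"]
      VH_value_simps(3)[of \<epsilon> k n] ge2(1)[of "k + 2"] ge2(2)[of "Suc k"]
    by (simp add: algebra_simps del: word_value.simps)
qed (simp_all add: VH_value_simps algebra_simps)

lemma expr_value_stage_0:
  "expr_value \<epsilon> (stage b 0) = T3_bracket 3 \<epsilon> * VH_value \<epsilon> 3 (b - 3)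
    + entry_value f2pm (\<epsilon> 1) * (word_value \<epsilon> 2 [H] * VH_value \<epsilon> 4 (b - 4))"
  by (simp add: expr_value_def stage_def VH_value_def image_mset.compositionality comp_def
      sum_mset_distrib_left[symmetric] mult.assoc numeral_eq_Suc del: tuple_value.simps entry_value.simps)


lemma crossing_signsD: "\<epsilon> \<in> crossing_signs b \<Longrightarrow> 1 \<le> k \<Longrightarrow> k < b \<Longrightarrow> \<epsilon> k \<in> {1, - 1}"
  unfolding crossing_signs_def by (erule Pi_mem) simp

lemma T3_bracket_recursion_words:
  assumes "\<epsilon> \<in> crossing_signs (Suc (Suc (Suc x)))"
  shows "T3_bracket (Suc (Suc (Suc x))) \<epsilon> =
      word_value \<epsilon> (Suc (Suc x)) [V] * T3_bracket (Suc (Suc x)) \<epsilon>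
    + word_value \<epsilon> (Suc x) [H] * T3_bracket (Suc x) \<epsilon>"
  using T3_bracket_recursion[of \<epsilon> x] crossing_signsD[OF assms]
  by (simp add: mult.commute mult.left_commute)

lemma T3_bracket_3:
  assumes "\<epsilon> \<in> crossing_signs 3"
  shows "T3_bracket 3 \<epsilon> = tuple_value \<epsilon> 1 [f2pm, Apm] + tuple_value \<epsilon> 1 [f2mp, Amp]"
  using T3_bracket_recursion_words[of \<epsilon> 0] assms T3_bracket_1 T3_bracket_2[of \<epsilon>]
    crossing_signsD[OF assms, of 1]
  by (simp add: numeral_3_eq_3 numeral_2_eq_2 mult.commute)

text \<open>Both sides obey the same recursion in \<open>n\<close> and agree for \<open>n = 0\<close> and \<open>n = 1\<close>.\<close>

lemma T3_bracket_eq_expr_value: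
  assumes "\<epsilon> \<in> crossing_signs (n + 4)"
  shows "T3_bracket (n + 4) \<epsilon> = expr_value \<epsilon> (stage (n + 4) 0)"
proof -
  let ?f3 = "T3_bracket 3 \<epsilon>" and ?f2 = "entry_value f2pm (\<epsilon> 1)"
  have rec: "T3_bracket (x + 3) \<epsilon> = word_value \<epsilon> (x + 2) [V] * T3_bracket (x + 2) \<epsilon>
      + word_value \<epsilon> (x + 1) [H] * T3_bracket (x + 1) \<epsilon>" if "x \<le> Suc n" for x
  proof -
    have "\<epsilon> \<in> crossing_signs (Suc (Suc (Suc x)))"
      using assms that unfolding crossing_signs_def by auto
    from T3_bracket_recursion_words[OF this] show ?thesis by (simp add: numeral_eq_Suc)
  qed
  have f2: "T3_bracket 2 \<epsilon> = ?f2"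
    using T3_bracket_2 crossing_signsD[OF assms, of 1] by simp
  have "T3_bracket (m + 4) \<epsilon> = ?f3 * VH_value \<epsilon> 3 (Suc m)
      + ?f2 * (word_value \<epsilon> 2 [H] * VH_value \<epsilon> 4 m)" if "m \<le> n" for m
    using that
  proof (induction m rule: induct_nat_012)
    case 0
    from rec[of 1] f2 show ?case
      by (simp add: VH_value_simps numeral_eq_Suc mult.commute del: word_value.simps entry_value.simps)
  next
    case 1
    from rec[of 1] rec[of 2] f2 1 show ?case
      by (simp add: VH_value_simps numeral_eq_Suc algebra_simps del: word_value.simps entry_value.simps)
  next
    case (ge2 m)
    have "T3_bracket (Suc (Suc m) + 4) \<epsilon> = word_value \<epsilon> (m + 5) [V] * T3_bracket (Suc m + 4) \<epsilon>
        + word_value \<epsilon> (m + 4) [H] * T3_bracket (m + 4) \<epsilon>"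
      using rec[of "m + 3"] ge2.prems by (simp add: add.commute del: word_value.simps)
    moreover have "VH_value \<epsilon> 3 (Suc (Suc (Suc m))) =
        word_value \<epsilon> (m + 5) [V] * VH_value \<epsilon> 3 (Suc (Suc m))
      + word_value \<epsilon> (m + 4) [H] * VH_value \<epsilon> 3 (Suc m)"
      using VH_value_last[of \<epsilon> 3 "Suc m"] by (simp add: add.commute del: word_value.simps)
    moreover have "VH_value \<epsilon> 4 (Suc (Suc m)) =
        word_value \<epsilon> (m + 5) [V] * VH_value \<epsilon> 4 (Suc m)
      + word_value \<epsilon> (m + 4) [H] * VH_value \<epsilon> 4 m"
      using VH_value_last[of \<epsilon> 4 m] by (simp add: add.commute del: word_value.simps)
    ultimately show ?case
      using ge2.IH ge2.prems
      by (simp add: algebra_simps del: word_value.simps entry_value.simps)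
  qed
  from this[of n] show ?thesis by (simp add: expr_value_stage_0)
qed

theorem theorem3p6:
  fixes F :: "nat \<Rightarrow> summand multiset"
  assumes start: "F 4 = {# (f3, [V]), (f2, [H]) #}"
    and rules: "\<And>b. b \<ge> 5 \<Longrightarrow> F b = apply_rules (F (b - 1))"
  shows "(\<forall>b \<ge> 4. \<forall>\<epsilon> \<in> crossing_signs b. T3_bracket b \<epsilon> = expr_value \<epsilon> (F b))
    \<and> (\<forall>b \<ge> 4. C_substituted_from_left (unfold_C (F b)) (F b))
    \<and> (\<forall>\<epsilon> \<in> crossing_signs 3.
          T3_bracket 3 \<epsilon> = tuple_value \<epsilon> 1 [f2pm, Apm] + tuple_value \<epsilon> 1 [f2mp, Amp])
    \<and> F 5 = {# (f3, [C]), (f2, [H, V]) #}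
    \<and> F 6 = {# (f3, [C, V]), (f3, [V, H]), (f2, [H, C]) #}
    \<and> F 7 = {# (f3, [C, C]), (f3, [V, H, V]),
               (f2, [H, C, V]), (f2, [H, V, H]) #}
    \<and> F 8 = {# (f3, [C, C, V]), (f3, [C, V, H]), (f3, [V, H, C]),
               (f2, [H, C, C]), (f2, [H, V, H, V]) #}
    \<and> F 9 = {# (f3, [C, C, C]), (f3, [C, V, H, V]),
               (f3, [V, H, C, V]), (f3, [V, H, V, H]),
               (f2, [H, C, C, V]), (f2, [H, C, V, H]), (f2, [H, V, H, C]) #}
    \<and> F 10 = {# (f3, [C, C, C, V]), (f3, [C, C, V, H]),
                (f3, [C, V, H, C]), (f3, [V, H, C, C]), (f3, [V, H, V, H, V]),
                (f2, [H, C, C, C]), (f2, [H, C, V, H, V]),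
                (f2, [H, V, H, C, V]), (f2, [H, V, H, V, H]) #}"
proof -
  have stages: "F b = stage b b" if "b \<ge> 4" for b
    using recursion_stage[of F "b - 4", OF start rules] that by simp
  have "\<forall>b \<ge> 4. \<forall>\<epsilon> \<in> crossing_signs b. T3_bracket b \<epsilon> = expr_value \<epsilon> (F b)"
  proof (intro allI impI ballI)
    fix b \<epsilon> assume b: "4 \<le> (b::nat)" and "\<epsilon> \<in> crossing_signs b"
    then have "T3_bracket b \<epsilon> = expr_value \<epsilon> (stage b 0)"
      using T3_bracket_eq_expr_value[of \<epsilon> "b - 4"] by simp
    also have "\<dots> = expr_value \<epsilon> (F b)"
      using expr_value_unfold_C[of \<epsilon> "stage b b"] stages[OF b] unfold_C_stage by simp
    finally show "T3_bracket b \<epsilon> = expr_value \<epsilon> (F b)" .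
  qed
  moreover have "\<forall>b \<ge> 4. C_substituted_from_left (unfold_C (F b)) (F b)"
  proof (intro allI impI)
    fix b assume b: "4 \<le> (b::nat)"
    show "C_substituted_from_left (unfold_C (F b)) (F b)"
      unfolding C_substituted_from_left_def stages[OF b] unfold_C_stage
      using stage_0_leftmost[of b b] stage_irreducible[of _ "b - 4"] b by simp
  qed
  moreover have F5: "F 5 = {# (f3, [C]), (f2, [H, V]) #}"
    using rules[of 5] start by (simp add: apply_rules_def)
  moreover have F6: "F 6 = {# (f3, [C, V]), (f3, [V, H]), (f2, [H, C]) #}"
    using rules[of 6] F5 by (simp add: apply_rules_def)
  moreover have F7: "F 7 = {# (f3, [C, C]), (f3, [V, H, V]),
               (f2, [H, C, V]), (f2, [H, V, H]) #}"
    using rules[of 7] F6 by (simp add: apply_rules_def)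
  moreover have F8: "F 8 = {# (f3, [C, C, V]), (f3, [C, V, H]), (f3, [V, H, C]),
               (f2, [H, C, C]), (f2, [H, V, H, V]) #}"
    using rules[of 8] F7 by (simp add: apply_rules_def)
  moreover have F9: "F 9 = {# (f3, [C, C, C]), (f3, [C, V, H, V]),
               (f3, [V, H, C, V]), (f3, [V, H, V, H]),
               (f2, [H, C, C, V]), (f2, [H, C, V, H]), (f2, [H, V, H, C]) #}"
    using rules[of 9] F8 by (simp add: apply_rules_def)
  moreover have "F 10 = {# (f3, [C, C, C, V]), (f3, [C, C, V, H]),
                (f3, [C, V, H, C]), (f3, [V, H, C, C]), (f3, [V, H, V, H, V]),
                (f2, [H, C, C, C]), (f2, [H, C, V, H, V]),
                (f2, [H, V, H, C, V]), (f2, [H, V, H, V, H]) #}"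
    using rules[of 10] F9 by (simp add: apply_rules_def)
  ultimately show ?thesis
    using T3_bracket_3 by (intro conjI ballI) assumption+
qed

end
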